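(* Let $X$ and $Y$ be complete, doubling metric spaces that are locally path-connected. Let $\Omega\subseteq X$ and $\Omega'\subseteq Y$ be bounded domains, and let $f:\Omega\to\Omega'$ be a branched quasisymmetric (BQS) homeomorphism. Then $f$ induces a homeomorphism $f_P:\overline{\Omega}^P\to\overline{\Omega'}^P$ between the prime end closures (that is, the map given by $f_P|_\Omega=f$ and $f_P([E_k])=[f(E_k)]$ for prime ends $[E_k]\in\partial_P\Omega$ is a well-defined homeomorphism).
   Context: A metric space is doubling if there is a positive integer $N$ such that every ball of radius $r$ can be covered by at most $N$ balls of radius $r/2$. A domain is a non-empty open connected set. A continuum is a compact connected set; it is nondegenerate if it has at least two points. BQS: a homeomorphism $f:\Omega\to\Omega'$ is a branched quasisymmetric (BQS) homeomorphism if there is a monotone increasing $\eta:(0,\infty)\to(0,\infty)$ with $\lim_{t\to0^+}\eta(t)=0$ such that for all nondegenerate continua $E,F\subset\Omega$ with $E\cap F\neq\emptyset$, $\frac{\operatorname{diam} f(E)}{\operatorname{diam} f(F)}\le\eta\left(\frac{\operatorname{diam}E}{\operatorname{diam}F}\right)$. Mazurkiewicz metric on $\Omega$: $d_M(x,y)=\inf_E\operatorname{diam}(E)$ over continua $E\subset\Omega$ containing $x,y$. For $A,B\subset\Omega$, $\operatorname{dist}_M(A,B)=\inf_\gamma\operatorname{diam}(\gamma)$ over continua $\gamma\subset\Omega$ meeting both $A$ and $B$ (infimum of the empty set is $\infty$). Prime ends. Closures and boundaries are taken in $X$. A bounded connected set $E\subseteq\Omega$ is acceptable if $\overline E$ is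 compact and $\overline E\cap\partial\Omega\ne\emptyset$. A chain is a sequence $\{E_k\}$ of acceptable sets with (a) $E_{k+1}\subseteq E_k$; (b) $\operatorname{dist}_M(\Omega\cap\partial E_{k+1},\Omega\cap\partial E_k)>0$; (c) $\bigcap_k\overline{E_k}\subseteq\partial\Omega$. A chain $\{E_k\}$ divides a chain $\{F_k\}$, written $\{E_k\}\,|\,\{F_k\}$, if for each $k$ there is $i_k$ with $E_{i_k}\subseteq F_k$. Two chains are equivalent if each divides the other; an end is an equivalence class $[E_k]$ of chains, and divisibility passes to ends. An end $\mathscr E$ is a prime end if every end $\mathscr F$ with $\mathscr F\,|\,\mathscr E$ equals $\mathscr E$. The prime end boundary $\partial_P\Omega$ is the set of prime ends, and $\overline\Omega^P=\Omega\cup\partial_P\Omega$. Topology of $\overline\Omega^P$: the topology determined by the following sequential convergence (a set is closed iff it contains all limits of sequences in it). Convergence to a point of $\Omega$ is the usual metric convergence (with the tail of the sequence in $\Omega$). A sequence $\{x_j\}\subset\Omega$ converges to a prime end $[E_k]$ if for each $k$ there is $N_k$ with $x_j\in E_k$ for all $j\ge N_k$. A sequence of prime ends $[E_{m,j}]_m$, $j\in\mathbb N$, converges to a prime end $[E_k]$ if for each $k$ there is $N_k$ such that for each $j\ge N_k$ there is $m_{j,k}$ with $E_{m_{j,k},j}\subset E_k$. *)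

theory Defs
  imports "HOL-Analysis.Analysis"
begin

definition doubling :: "'a::metric_space set \<Rightarrow> bool" where
  "doubling S \<longleftrightarrow>
     (\<exists>N::nat. N > 0 \<and>
       (\<forall>x\<in>S. \<forall>r>0. \<exists>C\<subseteq>S. finite C \<and> card C \<le> N \<and> S \<inter> ball x r \<subseteq> (\<Union>c\<in>C. ball c (r / 2))))"

definition "domain" :: "'a::topological_space set \<Rightarrow> bool" where
  "domain \<Omega> \<longleftrightarrow> \<Omega> \<noteq> {} \<and> open \<Omega> \<and> connected \<Omega>"

definition continuum :: "'a::topological_space set \<Rightarrow> bool" where
  "continuum E \<longleftrightarrow> compact E \<and> connected E"

definition nondegenerate_continuum :: "'a::topological_space set \<Rightarrow> bool" where
  "nondegenerate_continuum E \<longleftrightarrow> continuum E \<and> (\<exists>x\<in>E. \<exists>y\<in>E. x \<noteq> y)"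

definition BQS_homeomorphism ::
    "'a::metric_space set \<Rightarrow> 'b::metric_space set \<Rightarrow> ('a \<Rightarrow> 'b) \<Rightarrow> bool" where
  "BQS_homeomorphism \<Omega> \<Omega>' f \<longleftrightarrow>
     (\<exists>g. homeomorphism \<Omega> \<Omega>' f g) \<and>
     (\<exists>\<eta>::real \<Rightarrow> real. (\<forall>t>0. \<eta> t > 0) \<and> mono_on {0<..} \<eta> \<and> (\<eta> \<longlongrightarrow> 0) (at_right 0) \<and>
       (\<forall>E F. nondegenerate_continuum E \<and> nondegenerate_continuum F \<and>
              E \<subseteq> \<Omega> \<and> F \<subseteq> \<Omega> \<and> E \<inter> F \<noteq> {} \<longrightarrow>
              diameter (f ` E) / diameter (f ` F) \<le> \<eta> (diameter E / diameter F)))"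

text \<open>The Mazurkiewicz distance between two sets; it is \<open>\<infinity>\<close> when no continuum in \<open>\<Omega>\<close> meets
  both sets.\<close>

definition dist_M :: "'a::metric_space set \<Rightarrow> 'a set \<Rightarrow> 'a set \<Rightarrow> ereal" where
  "dist_M \<Omega> A B =
     (INF \<gamma>\<in>{\<gamma>. continuum \<gamma> \<and> \<gamma> \<subseteq> \<Omega> \<and> \<gamma> \<inter> A \<noteq> {} \<and> \<gamma> \<inter> B \<noteq> {}}. ereal (diameter \<gamma>))"


section \<open>Ends and prime ends\<close>

definition acceptable :: "'a::metric_space set \<Rightarrow> 'a set \<Rightarrow> bool" where
  "acceptable \<Omega> E \<longleftrightarrow>
     bounded E \<and> connected E \<and> E \<subseteq> \<Omega> \<and> compact (closure E) \<and> closure E \<inter> frontier \<Omega> \<noteq> {}"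

definition chain :: "'a::metric_space set \<Rightarrow> (nat \<Rightarrow> 'a set) \<Rightarrow> bool" where
  "chain \<Omega> E \<longleftrightarrow>
     (\<forall>k. acceptable \<Omega> (E k)) \<and>
     (\<forall>k. E (Suc k) \<subseteq> E k) \<and>
     (\<forall>k. dist_M \<Omega> (\<Omega> \<inter> frontier (E (Suc k))) (\<Omega> \<inter> frontier (E k)) > 0) \<and>
     (\<Inter>k. closure (E k)) \<subseteq> frontier \<Omega>"

definition chain_divides :: "(nat \<Rightarrow> 'a set) \<Rightarrow> (nat \<Rightarrow> 'a set) \<Rightarrow> bool" where
  "chain_divides E F \<longleftrightarrow> (\<forall>k. \<exists>i. E i \<subseteq> F k)"

definition chain_equiv :: "'a::metric_space set \<Rightarrow> ((nat \<Rightarrow> 'a set) \<times> (nat \<Rightarrow> 'a set)) set" where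
  "chain_equiv \<Omega> =
     {(E, F). chain \<Omega> E \<and> chain \<Omega> F \<and> chain_divides E F \<and> chain_divides F E}"

definition end_of :: "'a::metric_space set \<Rightarrow> (nat \<Rightarrow> 'a set) \<Rightarrow> (nat \<Rightarrow> 'a set) set" where
  "end_of \<Omega> E = chain_equiv \<Omega> `` {E}"

definition ends :: "'a::metric_space set \<Rightarrow> (nat \<Rightarrow> 'a set) set set" where
  "ends \<Omega> = {E. chain \<Omega> E} // chain_equiv \<Omega>"

text \<open>The choice of representatives is immaterial, see \<open>end_divides_end_of\<close> below.\<close>

definition end_divides :: "(nat \<Rightarrow> 'a set) set \<Rightarrow> (nat \<Rightarrow> 'a set) set \<Rightarrow> bool" where
  "end_divides \<E> \<F> \<longleftrightarrow> (\<exists>E\<in>\<E>. \<exists>F\<in>\<F>. chain_divides E F)"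

definition prime_ends :: "'a::metric_space set \<Rightarrow> (nat \<Rightarrow> 'a set) set set" where
  "prime_ends \<Omega> = {\<E>\<in>ends \<Omega>. \<forall>\<F>\<in>ends \<Omega>. end_divides \<F> \<E> \<longrightarrow> \<F> = \<E>}"

lemma chain_divides_refl: "chain_divides E E"
  by (auto simp: chain_divides_def)

lemma chain_divides_trans: "chain_divides E F \<Longrightarrow> chain_divides F G \<Longrightarrow> chain_divides E G"
  unfolding chain_divides_def by (meson order_trans)

lemma equiv_chain_equiv: "equiv {E. chain \<Omega> E} (chain_equiv \<Omega>)"
  by (rule equivI)
     (auto simp: chain_equiv_def refl_on_def sym_def trans_def
           intro: chain_divides_refl chain_divides_trans)

lemma end_divides_end_of:
  assumes "chain \<Omega> E" "chain \<Omega> F"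
  shows "end_divides (end_of \<Omega> E) (end_of \<Omega> F) \<longleftrightarrow> chain_divides E F"
proof
  assume "end_divides (end_of \<Omega> E) (end_of \<Omega> F)"
  then obtain E' F' where "chain_divides E E'" "chain_divides E' F'" "chain_divides F' F"
    unfolding end_divides_def end_of_def chain_equiv_def by blast
  then show "chain_divides E F" using chain_divides_trans by metis
next
  assume "chain_divides E F"
  moreover have "E \<in> end_of \<Omega> E" "F \<in> end_of \<Omega> F"
    using assms by (simp_all add: end_of_def chain_equiv_def chain_divides_refl)
  ultimately show "end_divides (end_of \<Omega> E) (end_of \<Omega> F)"
    unfolding end_divides_def by blast
qed


section \<open>The prime end closure and its topology\<close>

type_synonym 'a pe_point = "'a + (nat \<Rightarrow> 'a set) set"

definition prime_end_closure :: "'a::metric_space set \<Rightarrow> 'a pe_point set" where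
  "prime_end_closure \<Omega> = \<Omega> <+> prime_ends \<Omega>"

text \<open>In the two relations below, quantifying over all representatives of the ends is the same as
  choosing some, see \<open>points_tendsto_end_iff\<close> and \<open>ends_tendsto_end_iff\<close>.\<close>

definition points_tendsto_end :: "(nat \<Rightarrow> 'a) \<Rightarrow> (nat \<Rightarrow> 'a set) set \<Rightarrow> bool" where
  "points_tendsto_end x \<E> \<longleftrightarrow> (\<forall>E\<in>\<E>. \<forall>k. \<exists>N. \<forall>j\<ge>N. x j \<in> E k)"

definition ends_tendsto_end ::
    "(nat \<Rightarrow> (nat \<Rightarrow> 'a set) set) \<Rightarrow> (nat \<Rightarrow> 'a set) set \<Rightarrow> bool" where
  "ends_tendsto_end \<P> \<E> \<longleftrightarrow>
     (\<forall>E\<in>\<E>. \<forall>k. \<exists>N. \<forall>j\<ge>N. \<forall>P\<in>\<P> j. \<exists>m. P m \<subseteq> E k)"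

lemma points_tendsto_end_iff:
  assumes "chain \<Omega> E"
  shows "points_tendsto_end x (end_of \<Omega> E) \<longleftrightarrow> (\<forall>k. \<exists>N. \<forall>j\<ge>N. x j \<in> E k)"
proof
  assume "points_tendsto_end x (end_of \<Omega> E)"
  moreover have "E \<in> end_of \<Omega> E"
    using assms by (auto simp: end_of_def chain_equiv_def chain_divides_refl)
  ultimately show "\<forall>k. \<exists>N. \<forall>j\<ge>N. x j \<in> E k"
    by (auto simp: points_tendsto_end_def)
next
  assume "\<forall>k. \<exists>N. \<forall>j\<ge>N. x j \<in> E k"
  moreover have "\<exists>i. E i \<subseteq> F k" if "F \<in> end_of \<Omega> E" for F k
    using that unfolding end_of_def chain_equiv_def chain_divides_def by blast
  ultimately show "points_tendsto_end x (end_of \<Omega> E)"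
    unfolding points_tendsto_end_def by (meson subsetD)
qed

lemma ends_tendsto_end_iff:
  assumes "chain \<Omega> E" "\<And>j. chain \<Omega> (P j)"
  shows "ends_tendsto_end (\<lambda>j. end_of \<Omega> (P j)) (end_of \<Omega> E) \<longleftrightarrow>
           (\<forall>k. \<exists>N. \<forall>j\<ge>N. \<exists>m. P j m \<subseteq> E k)"
proof
  assume lim: "ends_tendsto_end (\<lambda>j. end_of \<Omega> (P j)) (end_of \<Omega> E)"
  have self: "F \<in> end_of \<Omega> F" if "chain \<Omega> F" for F
    using that by (simp add: end_of_def chain_equiv_def chain_divides_refl)
  show "\<forall>k. \<exists>N. \<forall>j\<ge>N. \<exists>m. P j m \<subseteq> E k"
  proof
    fix k
    obtain N where N: "\<forall>j\<ge>N. \<forall>Q\<in>end_of \<Omega> (P j). \<exists>m. Q m \<subseteq> E k"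
      using lim self[OF assms(1)] unfolding ends_tendsto_end_def by blast
    have "\<exists>m. P j m \<subseteq> E k" if "j \<ge> N" for j
      using N[rule_format, OF that self[OF assms(2)]] .
    then show "\<exists>N. \<forall>j\<ge>N. \<exists>m. P j m \<subseteq> E k" by blast
  qed
next
  assume *: "\<forall>k. \<exists>N. \<forall>j\<ge>N. \<exists>m. P j m \<subseteq> E k"
  show "ends_tendsto_end (\<lambda>j. end_of \<Omega> (P j)) (end_of \<Omega> E)"
    unfolding ends_tendsto_end_def
  proof (intro ballI allI)
    fix F k assume "F \<in> end_of \<Omega> E"
    then obtain i where i: "E i \<subseteq> F k"
      unfolding end_of_def chain_equiv_def chain_divides_def by blast
    from * obtain N where N: "\<forall>j\<ge>N. \<exists>m. P j m \<subseteq> E i" by blast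
    have "\<exists>m. Q m \<subseteq> F k" if "j \<ge> N" and Q: "Q \<in> end_of \<Omega> (P j)" for j Q
    proof -
      obtain m where m: "P j m \<subseteq> E i" using N \<open>j \<ge> N\<close> by blast
      obtain n where "Q n \<subseteq> P j m"
        using Q unfolding end_of_def chain_equiv_def chain_divides_def by blast
      with m i show ?thesis by blast
    qed
    then show "\<exists>N. \<forall>j\<ge>N. \<forall>Q\<in>end_of \<Omega> (P j). \<exists>m. Q m \<subseteq> F k" by blast
  qed
qed

text \<open>Only sequences of points and sequences of prime ends are considered for convergence to a prime
  end.  Sequences mixing the two have a subsequence of one of these kinds, so that admitting them
  would not change the sequentially closed sets.\<close>

fun pe_tendsto :: "'a::metric_space set \<Rightarrow> (nat \<Rightarrow> 'a pe_point) \<Rightarrow> 'a pe_point \<Rightarrow> bool" where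
  "pe_tendsto \<Omega> s (Inl x) \<longleftrightarrow>
     x \<in> \<Omega> \<and> (\<exists>y N. (\<forall>j\<ge>N. y j \<in> \<Omega> \<and> s j = Inl (y j)) \<and> y \<longlonglongrightarrow> x)"
| "pe_tendsto \<Omega> s (Inr \<E>) \<longleftrightarrow>
     \<E> \<in> prime_ends \<Omega> \<and>
     ((\<exists>x. (\<forall>j. x j \<in> \<Omega> \<and> s j = Inl (x j)) \<and> points_tendsto_end x \<E>) \<or>
      (\<exists>\<P>. (\<forall>j. \<P> j \<in> prime_ends \<Omega> \<and> s j = Inr (\<P> j)) \<and> ends_tendsto_end \<P> \<E>))"

definition pe_closed :: "'a::metric_space set \<Rightarrow> 'a pe_point set \<Rightarrow> bool" where
  "pe_closed \<Omega> C \<longleftrightarrow>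
     C \<subseteq> prime_end_closure \<Omega> \<and>
     (\<forall>s l. (\<forall>j. s j \<in> C) \<and> pe_tendsto \<Omega> s l \<longrightarrow> l \<in> C)"

definition pe_topology :: "'a::metric_space set \<Rightarrow> 'a pe_point topology" where
  "pe_topology \<Omega> =
     topology (\<lambda>U. U \<subseteq> prime_end_closure \<Omega> \<and> pe_closed \<Omega> (prime_end_closure \<Omega> - U))"

lemma pe_tendsto_in: "pe_tendsto \<Omega> s l \<Longrightarrow> l \<in> prime_end_closure \<Omega>"
  by (cases l) (auto simp: prime_end_closure_def)

lemma pe_tendsto_subseq:
  assumes "pe_tendsto \<Omega> s l" "strict_mono r"
  shows "pe_tendsto \<Omega> (s \<circ> r) l"
proof (cases l)
  case (Inl x)
  then obtain y N where x: "x \<in> \<Omega>" and y: "\<forall>j\<ge>N. y j \<in> \<Omega> \<and> s j = Inl (y j)" "y \<longlonglongrightarrow> x"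
    using assms(1) by auto
  have "\<forall>j\<ge>N. (y \<circ> r) j \<in> \<Omega> \<and> (s \<circ> r) j = Inl ((y \<circ> r) j)"
  proof (intro allI impI)
    fix j assume "N \<le> j"
    then have "N \<le> r j" using seq_suble[OF assms(2), of j] by linarith
    then show "(y \<circ> r) j \<in> \<Omega> \<and> (s \<circ> r) j = Inl ((y \<circ> r) j)" using y(1) by simp
  qed
  moreover have "(y \<circ> r) \<longlonglongrightarrow> x"
    using y(2) assms(2) by (rule LIMSEQ_subseq_LIMSEQ)
  ultimately show ?thesis unfolding Inl pe_tendsto.simps using x by blast
next
  case (Inr \<E>)
  have le: "j \<le> r j" for j by (rule seq_suble[OF assms(2)])
  have sub1: "points_tendsto_end (x \<circ> r) \<E>" if x: "points_tendsto_end x \<E>" for x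
    unfolding points_tendsto_end_def
  proof (intro ballI allI)
    fix E k assume "E \<in> \<E>"
    then obtain N where "\<forall>j\<ge>N. x j \<in> E k" using x unfolding points_tendsto_end_def by blast
    then have "\<forall>j\<ge>N. (x \<circ> r) j \<in> E k" using order_trans[OF _ le] by simp
    then show "\<exists>N. \<forall>j\<ge>N. (x \<circ> r) j \<in> E k" by blast
  qed
  have sub2: "ends_tendsto_end (\<P> \<circ> r) \<E>" if \<P>: "ends_tendsto_end \<P> \<E>" for \<P>
    unfolding ends_tendsto_end_def
  proof (intro ballI allI)
    fix E k assume "E \<in> \<E>"
    then obtain N where "\<forall>j\<ge>N. \<forall>P\<in>\<P> j. \<exists>m. P m \<subseteq> E k"
      using \<P> unfolding ends_tendsto_end_def by blast
    then have "\<forall>j\<ge>N. \<forall>P\<in>(\<P> \<circ> r) j. \<exists>m. P m \<subseteq> E k"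
      unfolding comp_def using order_trans[OF _ le] by blast
    then show "\<exists>N. \<forall>j\<ge>N. \<forall>P\<in>(\<P> \<circ> r) j. \<exists>m. P m \<subseteq> E k" by blast
  qed
  have \<E>: "\<E> \<in> prime_ends \<Omega>" using assms(1) Inr by auto
  from assms(1) Inr consider
    x where "\<forall>j. x j \<in> \<Omega> \<and> s j = Inl (x j)" "points_tendsto_end x \<E>" |
    \<P> where "\<forall>j. \<P> j \<in> prime_ends \<Omega> \<and> s j = Inr (\<P> j)" "ends_tendsto_end \<P> \<E>"
    by auto
  then show ?thesis
  proof cases
    case 1
    then show ?thesis unfolding Inr pe_tendsto.simps using \<E> sub1
      by (intro conjI disjI1 exI[of _ "x \<circ> r"]) auto
  next
    case 2
    then show ?thesis unfolding Inr pe_tendsto.simps using \<E> sub2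
      by (intro conjI disjI2 exI[of _ "\<P> \<circ> r"]) auto
  qed
qed

lemma pe_closed_Un:
  assumes "pe_closed \<Omega> A" "pe_closed \<Omega> B"
  shows "pe_closed \<Omega> (A \<union> B)"
  unfolding pe_closed_def
proof (intro conjI allI impI)
  show "A \<union> B \<subseteq> prime_end_closure \<Omega>" using assms by (auto simp: pe_closed_def)
  fix s l assume s: "(\<forall>j. s j \<in> A \<union> B) \<and> pe_tendsto \<Omega> s l"
  have sub: "l \<in> C" if inf: "infinite {j. s j \<in> C}" and C: "pe_closed \<Omega> C" for C
  proof -
    obtain r :: "nat \<Rightarrow> nat" where r: "strict_mono r" "\<And>n. r n \<in> {j. s j \<in> C}"
      using infinite_enumerate[OF inf] by blast
    have "pe_tendsto \<Omega> (s \<circ> r) l" using s r(1) pe_tendsto_subseq by blast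
    moreover have "\<forall>j. (s \<circ> r) j \<in> C" using r(2) by simp
    ultimately show ?thesis using C unfolding pe_closed_def by blast
  qed
  have "{j. s j \<in> A} \<union> {j. s j \<in> B} = UNIV" using s by auto
  then have "infinite {j. s j \<in> A} \<or> infinite {j. s j \<in> B}"
    by (metis finite_Un infinite_UNIV_nat)
  then show "l \<in> A \<union> B" using sub assms by blast
qed

lemma istopology_pe:
  "istopology (\<lambda>U. U \<subseteq> prime_end_closure \<Omega> \<and> pe_closed \<Omega> (prime_end_closure \<Omega> - U))"
  unfolding istopology_def
proof (intro conjI allI impI)
  fix S T
  assume S: "S \<subseteq> prime_end_closure \<Omega> \<and> pe_closed \<Omega> (prime_end_closure \<Omega> - S)"
    and T: "T \<subseteq> prime_end_closure \<Omega> \<and> pe_closed \<Omega> (prime_end_closure \<Omega> - T)"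
  then show "S \<inter> T \<subseteq> prime_end_closure \<Omega>" by blast
  show "pe_closed \<Omega> (prime_end_closure \<Omega> - S \<inter> T)"
    unfolding Diff_Int by (rule pe_closed_Un) (use S T in simp_all)
next
  fix \<K>
  assume K: "\<forall>K\<in>\<K>. K \<subseteq> prime_end_closure \<Omega> \<and> pe_closed \<Omega> (prime_end_closure \<Omega> - K)"
  then show "\<Union>\<K> \<subseteq> prime_end_closure \<Omega>" by blast
  show "pe_closed \<Omega> (prime_end_closure \<Omega> - \<Union>\<K>)"
    unfolding pe_closed_def
  proof (intro conjI allI impI)
    fix s l
    assume s: "(\<forall>j. s j \<in> prime_end_closure \<Omega> - \<Union>\<K>) \<and> pe_tendsto \<Omega> s l"
    have "l \<notin> K" if "K \<in> \<K>" for K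
    proof -
      have "\<forall>j. s j \<in> prime_end_closure \<Omega> - K" using s that by blast
      moreover have "pe_closed \<Omega> (prime_end_closure \<Omega> - K)" using K that by blast
      ultimately have "l \<in> prime_end_closure \<Omega> - K"
        using s unfolding pe_closed_def by blast
      then show ?thesis by blast
    qed
    then show "l \<in> prime_end_closure \<Omega> - \<Union>\<K>" using pe_tendsto_in[of \<Omega> s l] s by blast
  qed blast
qed

lemma openin_pe_topology:
  "openin (pe_topology \<Omega>) U \<longleftrightarrow>
     U \<subseteq> prime_end_closure \<Omega> \<and> pe_closed \<Omega> (prime_end_closure \<Omega> - U)"
  unfolding pe_topology_def by (simp add: istopology_pe topology_inverse')

lemma topspace_pe_topology: "topspace (pe_topology \<Omega>) = prime_end_closure \<Omega>"
proof -
  have "pe_closed \<Omega> {}"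
    unfolding pe_closed_def by auto
  then have "openin (pe_topology \<Omega>) (prime_end_closure \<Omega>)"
    by (simp add: openin_pe_topology)
  then show ?thesis
    by (meson openin_pe_topology openin_subset openin_topspace subset_antisym)
qed

lemma closedin_pe_topology: "closedin (pe_topology \<Omega>) C \<longleftrightarrow> pe_closed \<Omega> C"
proof (cases "C \<subseteq> prime_end_closure \<Omega>")
  case True
  then have "prime_end_closure \<Omega> - (prime_end_closure \<Omega> - C) = C" by blast
  with True show ?thesis
    unfolding closedin_def topspace_pe_topology openin_pe_topology by simp
next
  case False
  then show ?thesis
    unfolding closedin_def topspace_pe_topology pe_closed_def by simp
qed

end

theory Submission
  imports Defs
begin

text \<open>
  Compare a continuum \<open>\<gamma>\<close> in \<open>\<Omega>\<close> with a continuum joining \<open>\<gamma>\<close> to a fixed pair of distinct points; the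
  latter and its image have diameters bounded above and below, since the domains are bounded and
  path-connected.  The BQS inequality, used in both roles, then shows that \<open>diam \<gamma>\<close> and
  \<open>diam f(\<gamma>)\<close> control each other, i.e. \<open>f\<close> is bi-uniformly continuous for the Mazurkiewicz metrics.
  Hence \<open>f\<close> and its inverse preserve condition (b) for chains; the other conditions are topological
  because bounded closed sets are compact.  So \<open>f\<close> induces a bijection of chains preserving
  divisibility, and with it everything defined in terms of chains.
\<close>

section \<open>Metric preliminaries\<close>

text \<open>Apply the doubling condition \<open>n\<close> times: each step replaces every ball of
  the current cover by finitely many balls of half the radius. Total boundedness asks only for
  finiteness, so the count is not tracked.\<close>

lemma doubling_ball_finite_cover:
  assumes "doubling (UNIV :: 'a::metric_space set)" "r > 0"
  shows "\<exists>C. finite C \<and> ball (x::'a) r \<subseteq> (\<Union>c\<in>C. ball c (r / 2 ^ n))"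
proof (induction n)
  case 0
  show ?case by (rule exI[of _ "{x}"]) simp
next
  case (Suc n)
  then obtain C where C: "finite C" "ball x r \<subseteq> (\<Union>c\<in>C. ball c (r / 2 ^ n))"
    by blast
  have "\<exists>D. finite D \<and> ball c (r / 2 ^ n) \<subseteq> (\<Union>d\<in>D. ball d (r / 2 ^ Suc n))" for c :: 'a
  proof -
    obtain N :: nat where
      N: "\<forall>x::'a. \<forall>r>0. \<exists>C. finite C \<and> card C \<le> N \<and> ball x r \<subseteq> (\<Union>c\<in>C. ball c (r / 2))"
      using assms(1) unfolding doubling_def by auto
    have "r / 2 ^ n > 0" using assms(2) by simp
    then obtain D where "finite D" "ball c (r / 2 ^ n) \<subseteq> (\<Union>d\<in>D. ball d (r / 2 ^ n / 2))"
      using N by blast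
    then show ?thesis by (intro exI[of _ D]) (simp add: mult.commute)
  qed
  then obtain D :: "'a \<Rightarrow> 'a set" where D: "\<And>c. finite (D c)"
    "\<And>c. ball c (r / 2 ^ n) \<subseteq> (\<Union>d\<in>D c. ball d (r / 2 ^ Suc n))"
    by metis
  have "ball x r \<subseteq> (\<Union>c\<in>C. \<Union>d\<in>D c. ball d (r / 2 ^ Suc n))"
    using D(2) by (intro order_trans[OF C(2)] UN_mono) auto
  then have "ball x r \<subseteq> (\<Union>d\<in>(\<Union>c\<in>C. D c). ball d (r / 2 ^ Suc n))"
    by (simp only: UN_UN_flatten)
  moreover have "finite (\<Union>c\<in>C. D c)" using C(1) D(1) by blast
  ultimately show ?case by blast
qed

text \<open>Complete doubling spaces are proper: the closure is complete, and repeated halving of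
  radii makes it totally bounded. This supplies the compactness clause of \<open>acceptable\<close>
  for subsets of bounded domains.\<close>

lemma compact_closure_if_doubling:
  fixes S :: "'a::metric_space set"
  assumes "complete (UNIV :: 'a set)" "doubling (UNIV :: 'a set)" "bounded S"
  shows "compact (closure S)"
  unfolding compact_eq_totally_bounded
proof (intro conjI allI impI)
  show "complete (closure S)"
    by (rule complete_closed_subset[OF _ _ assms(1)]) auto
  fix e :: real assume "e > 0"
  obtain x r where r: "r > 0" "closure S \<subseteq> ball x r"
    using bounded_closure[OF assms(3)] by (metis bounded_subset_ballD)
  have "\<exists>n. r / e < 2 ^ n" by (rule real_arch_pow) simp
  then obtain n where "r / e < 2 ^ n" by blast
  then have n: "r / 2 ^ n \<le> e" using \<open>e > 0\<close> by (simp add: field_simps)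
  obtain C where "finite C" "ball x r \<subseteq> (\<Union>c\<in>C. ball c (r / 2 ^ n))"
    using doubling_ball_finite_cover[OF assms(2) r(1)] by blast
  moreover have "(\<Union>c\<in>C. ball c (r / 2 ^ n)) \<subseteq> (\<Union>c\<in>C. ball c e)"
    using n by (intro UN_mono subset_ball) auto
  ultimately show "\<exists>k. finite k \<and> closure S \<subseteq> (\<Union>x\<in>k. ball x e)"
    using r(2) by (intro exI[of _ C]) (meson order_trans)
qed

text \<open>Paths supply the continua that join prescribed points inside the domain. Openness passes
  local path-connectedness to the domain, where components and path components then
  coincide.\<close>

lemma path_connected_domain:
  fixes \<Omega> :: "'a::metric_space set"
  assumes "locally path_connected (UNIV :: 'a set)" "domain \<Omega>"
  shows "path_connected \<Omega>"
proof -
  have "locally path_connected \<Omega>"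
    using assms by (intro locally_open_subset[OF assms(1)]) (auto simp: domain_def)
  then have "path_component_set \<Omega> x = connected_component_set \<Omega> x" for x
    by (rule path_component_eq_connected_component_set)
  then show ?thesis
    using assms(2) unfolding path_connected_component_set domain_def
    by (metis connected_component_eq_self)
qed

text \<open>Three points are joined because a reference continuum has to contain a fixed pair and
  also meet a given continuum.\<close>

lemma path_connected_join_continuum:
  assumes "path_connected \<Omega>" "x \<in> \<Omega>" "y \<in> \<Omega>" "z \<in> \<Omega>"
  obtains F where "continuum F" "F \<subseteq> \<Omega>" "x \<in> F" "y \<in> F" "z \<in> F"
proof -
  obtain p q where p: "path p" "path_image p \<subseteq> \<Omega>" "pathstart p = x" "pathfinish p = y"
    and q: "path q" "path_image q \<subseteq> \<Omega>" "pathstart q = y" "pathfinish q = z"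
    using assms unfolding path_connected_def by metis
  have "continuum (path_image (p +++ q))"
    using p q by (auto simp: continuum_def)
  moreover have "path_image (p +++ q) = path_image p \<union> path_image q"
    using p q by (simp add: path_image_join)
  moreover have "x \<in> path_image p" "y \<in> path_image p" "z \<in> path_image q"
    using p q by (auto intro: pathstart_in_path_image pathfinish_in_path_image)
  ultimately show ?thesis using that[of "path_image p \<union> path_image q"] p q by auto
qed

lemma continuum_image:
  assumes "continuous_on \<Omega> f" "continuum \<gamma>" "\<gamma> \<subseteq> \<Omega>"
  shows "continuum (f ` \<gamma>)"
  using assms unfolding continuum_def
  by (meson compact_continuous_image connected_continuous_image continuous_on_subset)

lemma nondegenerate_continuum_diameter_pos:
  assumes "nondegenerate_continuum (E :: 'a::metric_space set)"
  shows "diameter E > 0"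
proof -
  obtain x y where "x \<in> E" "y \<in> E" "x \<noteq> y" "bounded E"
    using assms compact_imp_bounded unfolding nondegenerate_continuum_def continuum_def by blast
  then show ?thesis
    using diameter_bounded_bound[of E x y] by (metis less_le_trans zero_less_dist_iff)
qed

text \<open>Such a continuum is empty or a single point. The BQS inequality says nothing about
  these, so they are handled separately.\<close>

lemma diameter_image_degenerate:
  fixes f :: "'a::metric_space \<Rightarrow> 'b::metric_space"
  assumes "continuum E" "\<not> nondegenerate_continuum E"
  shows "diameter (f ` E) = 0"
proof -
  have "E = {} \<or> (\<exists>a. E = {a})"
    using assms unfolding nondegenerate_continuum_def by (metis all_not_in_conv is_singletonI' is_singletonE)
  then show ?thesis by auto
qed


section \<open>Small continua under BQS homeomorphisms\<close>

text \<open>For a homeomorphism between domains this is uniform continuity for the Mazurkiewicz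
  metrics, phrased through continua so that no infimum has to be handled.\<close>

definition preserves_small_continua ::
    "'a::metric_space set \<Rightarrow> ('a \<Rightarrow> 'b::metric_space) \<Rightarrow> bool" where
  "preserves_small_continua \<Omega> f \<longleftrightarrow>
     (\<forall>\<epsilon>>0. \<exists>\<delta>>0. \<forall>\<gamma>. continuum \<gamma> \<and> \<gamma> \<subseteq> \<Omega> \<and> diameter \<gamma> < \<delta> \<longrightarrow> diameter (f ` \<gamma>) < \<epsilon>)"

text \<open>Covers the case without two distinct points, where no reference continuum exists: every
  continuum is then degenerate.\<close>

lemma preserves_small_continua_subsingleton:
  assumes "\<And>x y. x \<in> \<Omega> \<Longrightarrow> y \<in> \<Omega> \<Longrightarrow> x = y"
  shows "preserves_small_continua \<Omega> f"
proof -
  have "diameter (f ` \<gamma>) = 0" if "continuum \<gamma>" "\<gamma> \<subseteq> \<Omega>" for \<gamma>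
    using that assms by (intro diameter_image_degenerate) (auto simp: nondegenerate_continuum_def)
  then show ?thesis unfolding preserves_small_continua_def by (metis zero_less_one)
qed

text \<open>The claim for \<open>f\<close> puts the small continuum in the numerator and uses the
  limit of \<open>\<eta>\<close> at 0; the claim for \<open>g\<close> puts it in the denominator and
  uses monotonicity of \<open>\<eta>\<close>.\<close>

lemma BQS_preserves_small_continua:
  fixes \<Omega> :: "'a::metric_space set" and \<Omega>' :: "'b::metric_space set"
  assumes hom: "homeomorphism \<Omega> \<Omega>' f g"
    and pc: "path_connected \<Omega>" and bd: "bounded \<Omega>" "bounded \<Omega>'"
    and \<eta>: "mono_on {0<..} \<eta>" "(\<eta> \<longlongrightarrow> 0) (at_right (0::real))"
    and bqs: "\<And>E F. nondegenerate_continuum E \<Longrightarrow> nondegenerate_continuum F \<Longrightarrow> E \<subseteq> \<Omega> \<Longrightarrow> F \<subseteq> \<Omega> \<Longrightarrow>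
           E \<inter> F \<noteq> {} \<Longrightarrow> diameter (f ` E) / diameter (f ` F) \<le> \<eta> (diameter E / diameter F)"
  shows "preserves_small_continua \<Omega> f" "preserves_small_continua \<Omega>' g"
proof -
  have f_img: "f ` \<Omega> = \<Omega>'" "g ` \<Omega>' = \<Omega>" and gf: "\<And>x. x \<in> \<Omega> \<Longrightarrow> g (f x) = x"
    and fg: "\<And>y. y \<in> \<Omega>' \<Longrightarrow> f (g y) = y" and cont: "continuous_on \<Omega> f" "continuous_on \<Omega>' g"
    using hom by (auto simp: homeomorphism_def)
  have "preserves_small_continua \<Omega> f \<and> preserves_small_continua \<Omega>' g"
  proof (cases "\<exists>a\<in>\<Omega>. \<exists>b\<in>\<Omega>. a \<noteq> b")
    case False
    moreover have "x = y" if "x \<in> \<Omega>'" "y \<in> \<Omega>'" for x y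
      using that False f_img by auto
    ultimately show ?thesis by (auto intro!: preserves_small_continua_subsingleton)
  next
    case True
    then obtain a b where ab: "a \<in> \<Omega>" "b \<in> \<Omega>" "a \<noteq> b" by blast
    define d D d' D' where "d = dist a b" and "D = diameter \<Omega>"
      and "d' = dist (f a) (f b)" and "D' = diameter \<Omega>'"
    have d: "d > 0" "d' > 0" using ab gf by (auto simp: d_def d'_def) metis
    have pos: "D > 0" "D' > 0"
      using d diameter_bounded_bound[OF bd(1) ab(1,2)] imageI[OF ab(1), of f] imageI[OF ab(2), of f]
        diameter_bounded_bound[OF bd(2), of "f a" "f b"]
      unfolding d_def D_def d'_def D'_def f_img by linarith+
    \<comment> \<open>\<open>F\<close> joins \<open>a\<close>, \<open>b\<close> and a point of
      \<open>\<gamma>\<close>. Containing \<open>a\<close> and \<open>b\<close> bounds the diameters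
      of \<open>F\<close> and its image from below, boundedness of the domains from above; none of
      the four bounds depends on \<open>\<gamma>\<close>.\<close>
    have ref: "\<exists>F. nondegenerate_continuum F \<and> F \<subseteq> \<Omega> \<and> \<gamma> \<inter> F \<noteq> {} \<and>
        d \<le> diameter F \<and> diameter F \<le> D \<and> d' \<le> diameter (f ` F) \<and> diameter (f ` F) \<le> D'"
      if \<gamma>: "nondegenerate_continuum \<gamma>" "\<gamma> \<subseteq> \<Omega>" for \<gamma>
    proof -
      obtain c where c: "c \<in> \<gamma>" using \<gamma> by (auto simp: nondegenerate_continuum_def)
      obtain F where F: "continuum F" "F \<subseteq> \<Omega>" "a \<in> F" "b \<in> F" "c \<in> F"
        using path_connected_join_continuum[OF pc ab(1,2)] c \<gamma>(2) by blast
      have sub: "f ` F \<subseteq> \<Omega>'" using F(2) f_img by blast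
      have "d \<le> diameter F" "d' \<le> diameter (f ` F)"
        unfolding d_def d'_def using F sub bd bounded_subset
        by (auto intro!: diameter_bounded_bound)
      moreover have "diameter F \<le> D" "diameter (f ` F) \<le> D'"
        unfolding D_def D'_def using F(2) sub bd by (auto intro!: diameter_subset)
      moreover have "nondegenerate_continuum F" "\<gamma> \<inter> F \<noteq> {}"
        using F ab c by (auto simp: nondegenerate_continuum_def)
      ultimately show ?thesis using F(2) by blast
    qed
    have "preserves_small_continua \<Omega> f"
      unfolding preserves_small_continua_def
    proof (intro allI impI)
      fix \<epsilon> :: real assume \<epsilon>: "\<epsilon> > 0"
      have "eventually (\<lambda>t. \<eta> t < \<epsilon> / D') (at_right 0)"
        using \<eta>(2) \<epsilon> pos by (intro order_tendstoD) auto
      then obtain t0 where t0: "t0 > 0" "\<And>t. 0 < t \<Longrightarrow> t < t0 \<Longrightarrow> \<eta> t < \<epsilon> / D'"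
        unfolding eventually_at_right_field by auto
      \<comment> \<open>Since \<open>F\<close> has diameter at least \<open>d\<close>, the threshold
        \<open>t0 * d\<close> keeps the ratio of diameters below \<open>t0\<close>. The image of
        \<open>F\<close> has diameter at most \<open>D'\<close>, which cancels the denominator in
        \<open>\<epsilon> / D'\<close>.\<close>
      have "diameter (f ` \<gamma>) < \<epsilon>" if \<gamma>: "continuum \<gamma>" "\<gamma> \<subseteq> \<Omega>" "diameter \<gamma> < t0 * d" for \<gamma>
      proof (cases "nondegenerate_continuum \<gamma>")
        case True
        obtain F where F: "nondegenerate_continuum F" "F \<subseteq> \<Omega>" "\<gamma> \<inter> F \<noteq> {}"
          "d \<le> diameter F" "d' \<le> diameter (f ` F)" "diameter (f ` F) \<le> D'"
          using ref[OF True \<gamma>(2)] by blast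
        let ?t = "diameter \<gamma> / diameter F"
        have "diameter \<gamma> > 0" by (rule nondegenerate_continuum_diameter_pos[OF True])
        moreover have "diameter \<gamma> < t0 * diameter F"
          using \<gamma>(3) mult_left_mono[OF F(4), of t0] t0(1) by linarith
        ultimately have "0 < ?t" "?t < t0" using F(4) d by (auto simp: field_simps)
        then have "\<eta> ?t < \<epsilon> / D'" by (rule t0)
        moreover have "diameter (f ` \<gamma>) / diameter (f ` F) \<le> \<eta> ?t"
          using bqs[OF True F(1) \<gamma>(2) F(2,3)] .
        ultimately have "diameter (f ` \<gamma>) / diameter (f ` F) < \<epsilon> / D'" by linarith
        then have "diameter (f ` \<gamma>) < \<epsilon> / D' * diameter (f ` F)"
          using F(5) d by (simp add: field_simps)
        also have "\<dots> \<le> \<epsilon> / D' * D'" using F(6) \<epsilon> pos by (intro mult_left_mono) auto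
        also have "\<dots> = \<epsilon>" using pos by simp
        finally show ?thesis .
      qed (use \<gamma> \<epsilon> in \<open>simp add: diameter_image_degenerate\<close>)
      then show "\<exists>\<delta>>0. \<forall>\<gamma>. continuum \<gamma> \<and> \<gamma> \<subseteq> \<Omega> \<and> diameter \<gamma> < \<delta> \<longrightarrow> diameter (f ` \<gamma>) < \<epsilon>"
        using t0(1) d(1) by (intro exI[of _ "t0 * d"]) auto
    qed
    moreover have "preserves_small_continua \<Omega>' g"
      unfolding preserves_small_continua_def
    proof (intro allI impI)
      fix \<epsilon> :: real assume \<epsilon>: "\<epsilon> > 0"
      \<comment> \<open>A positive upper bound for \<open>\<eta> (D / \<epsilon>)\<close>, so that
        dividing \<open>d'\<close> by it gives a positive threshold.\<close>
      let ?c = "\<bar>\<eta> (D / \<epsilon>)\<bar> + 1"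
      have "diameter (g ` \<gamma>) < \<epsilon>" if \<gamma>: "continuum \<gamma>" "\<gamma> \<subseteq> \<Omega>'" "diameter \<gamma> < d' / ?c" for \<gamma>
      proof (cases "nondegenerate_continuum \<gamma>")
        case True
        have cg: "continuum (g ` \<gamma>)" by (rule continuum_image[OF cont(2) \<gamma>(1,2)])
        have fg\<gamma>: "f ` g ` \<gamma> = \<gamma>" using \<gamma>(2) fg by force
        have ng: "nondegenerate_continuum (g ` \<gamma>)"
        proof (rule ccontr)
          assume "\<not> nondegenerate_continuum (g ` \<gamma>)"
          then have "diameter (f ` g ` \<gamma>) = 0" by (rule diameter_image_degenerate[OF cg])
          then show False using fg\<gamma> nondegenerate_continuum_diameter_pos[OF True] by simp
        qed
        have sub: "g ` \<gamma> \<subseteq> \<Omega>" using \<gamma>(2) f_img by blast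
        obtain F where F: "nondegenerate_continuum F" "F \<subseteq> \<Omega>" "g ` \<gamma> \<inter> F \<noteq> {}"
          "diameter F \<le> D" "d \<le> diameter F" "d' \<le> diameter (f ` F)"
          using ref[OF ng sub] by blast
        have gpos: "diameter (g ` \<gamma>) > 0" by (rule nondegenerate_continuum_diameter_pos[OF ng])
        have pos\<gamma>: "diameter \<gamma> > 0" by (rule nondegenerate_continuum_diameter_pos[OF True])
        show ?thesis
        proof (rule ccontr)
          \<comment> \<open>If the preimage of \<open>\<gamma>\<close> had diameter at least
            \<open>\<epsilon>\<close>, its ratio to \<open>F\<close> would be controlled by
            \<open>D / \<epsilon>\<close>; monotonicity then bounds the ratio of the images by
            \<open>?c\<close> and forces \<open>\<gamma>\<close> to be large.\<close>
          assume "\<not> ?thesis"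
          then have ge: "\<epsilon> \<le> diameter (g ` \<gamma>)" by simp
          have "diameter F / diameter (g ` \<gamma>) \<le> D / \<epsilon>"
            using F(4) ge \<epsilon> pos by (intro frac_le) auto
          moreover have "diameter F / diameter (g ` \<gamma>) > 0" using F(5) d gpos by auto
          ultimately have "\<eta> (diameter F / diameter (g ` \<gamma>)) \<le> \<eta> (D / \<epsilon>)"
            using \<eta>(1) \<epsilon> pos by (auto simp: mono_on_def)
          moreover have "diameter (f ` F) / diameter (f ` g ` \<gamma>) \<le> \<eta> (diameter F / diameter (g ` \<gamma>))"
            using bqs[OF F(1) ng F(2) sub] F(3) by blast
          ultimately have "diameter (f ` F) / diameter \<gamma> \<le> ?c" unfolding fg\<gamma> by linarith
          moreover have "d' / diameter \<gamma> \<le> diameter (f ` F) / diameter \<gamma>"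
            using F(6) pos\<gamma> by (intro divide_right_mono) auto
          ultimately have "d' / diameter \<gamma> \<le> ?c" by linarith
          moreover have "?c > 0" by linarith
          ultimately have "d' / ?c \<le> diameter \<gamma>" using pos\<gamma> by (simp add: field_simps)
          then show False using \<gamma>(3) by linarith
        qed
      qed (use \<gamma> \<epsilon> in \<open>simp add: diameter_image_degenerate\<close>)
      moreover have "d' / ?c > 0" using d(2) by (intro divide_pos_pos) linarith+
      ultimately show "\<exists>\<delta>>0. \<forall>\<gamma>. continuum \<gamma> \<and> \<gamma> \<subseteq> \<Omega>' \<and> diameter \<gamma> < \<delta> \<longrightarrow> diameter (g ` \<gamma>) < \<epsilon>"
        by blast
    qed
    ultimately show ?thesis by blast
  qed
  then show "preserves_small_continua \<Omega> f" "preserves_small_continua \<Omega>' g" by auto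
qed


section \<open>Images of chains\<close>

lemma homeomorphism_image_Int_closure:
  assumes "homeomorphism \<Omega> \<Omega>' f g" "E \<subseteq> \<Omega>"
  shows "f ` (\<Omega> \<inter> closure E) = \<Omega>' \<inter> closure (f ` E)"
proof -
  \<comment> \<open>Stated for an arbitrary homeomorphism, so that it applies to \<open>f\<close>
    and to \<open>g\<close>; the second use gives the reverse inclusion.\<close>
  have *: "h ` (A \<inter> closure S) \<subseteq> B \<inter> closure (h ` S)"
    if h: "homeomorphism A B h k" and S: "S \<subseteq> A"
    for A B S and h :: "'c::topological_space \<Rightarrow> 'd::topological_space" and k
  proof -
    have "continuous_on (A \<inter> closure S) h" "h ` A = B"
      using h by (auto simp: homeomorphism_def intro: continuous_on_subset)
    \<comment> \<open>By continuity the preimage of the closed set is the trace of some closed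
      \<open>T\<close>; since \<open>T\<close> contains \<open>S\<close>, it contains the closure of
      \<open>S\<close>.\<close>
    moreover have "closedin (top_of_set (A \<inter> closure S)) ((A \<inter> closure S) \<inter> h -` closure (h ` S))"
      using calculation(1) continuous_closedin_preimage[OF _ closed_closure] by blast
    then obtain T where "closed T" "(A \<inter> closure S) \<inter> h -` closure (h ` S) = (A \<inter> closure S) \<inter> T"
      by (auto simp: closedin_closed)
    moreover have "S \<subseteq> (A \<inter> closure S) \<inter> h -` closure (h ` S)"
      using S closure_subset[of S] closure_subset[of "h ` S"] by blast
    ultimately have "S \<subseteq> T" "closed T" by auto
    then have "closure S \<subseteq> T" by (rule closure_minimal)
    then show ?thesis
      using \<open>_ = (A \<inter> closure S) \<inter> T\<close> \<open>h ` A = B\<close> by blast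
  qed
  have gf: "g ` f ` E = E" "f ` E \<subseteq> \<Omega>'"
    using assms by (auto simp: homeomorphism_def image_image subset_iff)
  have "g ` (\<Omega>' \<inter> closure (f ` E)) \<subseteq> \<Omega> \<inter> closure E"
    using *[OF homeomorphism_symD[OF assms(1)] gf(2)] gf(1) by simp
  then have "f ` g ` (\<Omega>' \<inter> closure (f ` E)) \<subseteq> f ` (\<Omega> \<inter> closure E)" by (rule image_mono)
  moreover have "f ` g ` (\<Omega>' \<inter> closure (f ` E)) = \<Omega>' \<inter> closure (f ` E)"
    using assms(1) by (auto simp: homeomorphism_def image_image)
  ultimately show ?thesis using *[OF assms] by (intro subset_antisym) simp_all
qed

text \<open>Openness lets the frontier be written, inside the domain, as the intersection of the
  relative closures of the set and of its relative complement (\<open>fr\<close>). Both are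
  preserved by a homeomorphism, and injectivity moves the image through difference and
  intersection.\<close>

lemma homeomorphism_image_Int_frontier:
  assumes "homeomorphism \<Omega> \<Omega>' f g" "open \<Omega>" "open \<Omega>'" "E \<subseteq> \<Omega>"
  shows "f ` (\<Omega> \<inter> frontier E) = \<Omega>' \<inter> frontier (f ` E)"
proof -
  have fr: "U \<inter> frontier S = (U \<inter> closure S) \<inter> (U \<inter> closure (U - S))"
    if "open U" for U S :: "'c::topological_space set"
  proof -
    have "U \<inter> closure (- S) \<subseteq> closure (U - S)"
      using open_Int_closure_subset[OF that, of "- S"] by (simp add: Diff_eq)
    moreover have "closure (U - S) \<subseteq> closure (- S)" by (rule closure_mono) auto
    ultimately show ?thesis unfolding frontier_closures by blast
  qed
  have inj: "inj_on f \<Omega>" and im: "f ` \<Omega> = \<Omega>'"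
    using assms(1) by (auto simp: homeomorphism_def intro: inj_on_inverseI)
  have "f ` (\<Omega> - E) = \<Omega>' - f ` E"
    using inj_on_image_set_diff[OF inj _ assms(4), of \<Omega>] im by auto
  moreover have "f ` ((\<Omega> \<inter> closure E) \<inter> (\<Omega> \<inter> closure (\<Omega> - E))) =
      f ` (\<Omega> \<inter> closure E) \<inter> f ` (\<Omega> \<inter> closure (\<Omega> - E))"
    by (rule inj_on_image_Int[OF inj]) auto
  ultimately show ?thesis
    unfolding fr[OF assms(2)] fr[OF assms(3)]
    using homeomorphism_image_Int_closure[OF assms(1,4)]
      homeomorphism_image_Int_closure[OF assms(1), of "\<Omega> - E"] by simp
qed

section \<open>Mazurkiewicz distance and transfer of the chain conditions\<close>

lemma dist_M_pos_iff:
  "dist_M \<Omega> A B > 0 \<longleftrightarrow>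
     (\<exists>\<delta>>0. \<forall>\<gamma>. continuum \<gamma> \<and> \<gamma> \<subseteq> \<Omega> \<and> \<gamma> \<inter> A \<noteq> {} \<and> \<gamma> \<inter> B \<noteq> {} \<longrightarrow> \<delta> \<le> diameter \<gamma>)"
proof
  assume "dist_M \<Omega> A B > 0"
  then obtain \<delta> where \<delta>: "0 < ereal \<delta>" "ereal \<delta> < dist_M \<Omega> A B"
    using ereal_dense2 by blast
  have "\<delta> \<le> diameter \<gamma>" if "continuum \<gamma>" "\<gamma> \<subseteq> \<Omega>" "\<gamma> \<inter> A \<noteq> {}" "\<gamma> \<inter> B \<noteq> {}" for \<gamma>
  proof -
    have "dist_M \<Omega> A B \<le> ereal (diameter \<gamma>)"
      unfolding dist_M_def using that by (intro INF_lower) auto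
    then have "ereal \<delta> \<le> ereal (diameter \<gamma>)" using \<delta>(2) by (meson less_le_trans less_imp_le)
    then show ?thesis by simp
  qed
  then show "\<exists>\<delta>>0. \<forall>\<gamma>. continuum \<gamma> \<and> \<gamma> \<subseteq> \<Omega> \<and> \<gamma> \<inter> A \<noteq> {} \<and> \<gamma> \<inter> B \<noteq> {} \<longrightarrow> \<delta> \<le> diameter \<gamma>"
    using \<delta>(1) unfolding ereal_less(2) by blast
next
  assume "\<exists>\<delta>>0. \<forall>\<gamma>. continuum \<gamma> \<and> \<gamma> \<subseteq> \<Omega> \<and> \<gamma> \<inter> A \<noteq> {} \<and> \<gamma> \<inter> B \<noteq> {} \<longrightarrow> \<delta> \<le> diameter \<gamma>"
  then obtain \<delta> where \<delta>: "\<delta> > 0"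
    "\<And>\<gamma>. continuum \<gamma> \<Longrightarrow> \<gamma> \<subseteq> \<Omega> \<Longrightarrow> \<gamma> \<inter> A \<noteq> {} \<Longrightarrow> \<gamma> \<inter> B \<noteq> {} \<Longrightarrow> \<delta> \<le> diameter \<gamma>"
    by blast
  \<comment> \<open>This includes the case of no connecting continuum, where the infimum is
    \<infinity>.\<close>
  then have "ereal \<delta> \<le> dist_M \<Omega> A B"
    unfolding dist_M_def by (intro INF_greatest) auto
  with \<delta>(1) show "dist_M \<Omega> A B > 0" by (meson ereal_less(2) less_le_trans)
qed

text \<open>The delicate clause is that the closure reaches the boundary. Otherwise the closure of
  the image would be a compact subset of \<open>\<Omega>'\<close>; its image under \<open>g\<close>
  would be compact in \<open>\<Omega>\<close> and contain the closure of \<open>E\<close>, which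
  meets the frontier of \<open>\<Omega>\<close>.\<close>

lemma acceptable_image:
  fixes \<Omega> :: "'a::metric_space set" and \<Omega>' :: "'b::metric_space set"
  assumes hom: "homeomorphism \<Omega> \<Omega>' f g" and "open \<Omega>" "open \<Omega>'" "bounded \<Omega>'"
    and proper: "\<And>S::'b set. bounded S \<Longrightarrow> compact (closure S)"
    and E: "acceptable \<Omega> E"
  shows "acceptable \<Omega>' (f ` E)"
proof -
  have im: "f ` \<Omega> = \<Omega>'" "g ` \<Omega>' = \<Omega>" "continuous_on \<Omega> f" "continuous_on \<Omega>' g"
    and gf: "\<And>x. x \<in> \<Omega> \<Longrightarrow> g (f x) = x"
    using hom by (auto simp: homeomorphism_def)
  have E': "connected E" "E \<subseteq> \<Omega>" "closure E \<inter> frontier \<Omega> \<noteq> {}"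
    using E by (auto simp: acceptable_def)
  have sub: "f ` E \<subseteq> \<Omega>'" using E'(2) im by blast
  have bd: "bounded (f ` E)" using sub assms(4) bounded_subset by blast
  have "connected (f ` E)"
    using E' im by (meson connected_continuous_image continuous_on_subset)
  moreover have "closure (f ` E) \<inter> frontier \<Omega>' \<noteq> {}"
  proof
    assume emp: "closure (f ` E) \<inter> frontier \<Omega>' = {}"
    have "closure (f ` E) \<subseteq> closure \<Omega>'" using sub by (rule closure_mono)
    then have clsub: "closure (f ` E) \<subseteq> \<Omega>'"
      using emp \<open>open \<Omega>'\<close> by (auto simp: frontier_def interior_open)
    then have "compact (g ` closure (f ` E))"
      using proper[OF bd] im(4) by (meson compact_continuous_image continuous_on_subset)
    moreover have "E \<subseteq> g ` closure (f ` E)"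
    proof
      fix x assume "x \<in> E"
      then have "x = g (f x)" "f x \<in> closure (f ` E)" using gf E'(2) closure_subset[of "f ` E"] by auto
      then show "x \<in> g ` closure (f ` E)" by blast
    qed
    ultimately have "closure E \<subseteq> g ` closure (f ` E)"
      by (intro closure_minimal) (auto intro: compact_imp_closed)
    then have "closure E \<subseteq> \<Omega>" using clsub im(2) by blast
    then show False using E'(3) \<open>open \<Omega>\<close> by (auto simp: frontier_def interior_open)
  qed
  ultimately show ?thesis using bd sub proper[OF bd] by (auto simp: acceptable_def)
qed

text \<open>The smallness hypothesis concerns the inverse \<open>g\<close>: a short continuum
  joining two image frontiers would pull back to a short continuum joining the original ones,
  against condition (b).\<close>

lemma chain_image:
  fixes \<Omega> :: "'a::metric_space set" and \<Omega>' :: "'b::metric_space set"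
  assumes hom: "homeomorphism \<Omega> \<Omega>' f g" and op: "open \<Omega>" "open \<Omega>'" and bd: "bounded \<Omega>'"
    and proper: "\<And>S::'b set. bounded S \<Longrightarrow> compact (closure S)"
    and small: "preserves_small_continua \<Omega>' g"
    and E: "chain \<Omega> E"
  shows "chain \<Omega>' (\<lambda>k. f ` E k)"
  unfolding chain_def
proof (intro conjI allI)
  have im: "f ` \<Omega> = \<Omega>'" "g ` \<Omega>' = \<Omega>" "continuous_on \<Omega> f" "continuous_on \<Omega>' g"
    and gf: "\<And>x. x \<in> \<Omega> \<Longrightarrow> g (f x) = x"
    using hom by (auto simp: homeomorphism_def)
  have sub: "E k \<subseteq> \<Omega>" for k using E by (auto simp: chain_def acceptable_def)
  show "acceptable \<Omega>' (f ` E k)" for k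
    using acceptable_image[OF hom op bd proper] E by (auto simp: chain_def)
  show "f ` E (Suc k) \<subseteq> f ` E k" for k
    using E by (intro image_mono) (auto simp: chain_def)
  show "dist_M \<Omega>' (\<Omega>' \<inter> frontier (f ` E (Suc k))) (\<Omega>' \<inter> frontier (f ` E k)) > 0" for k
  proof -
    have "dist_M \<Omega> (\<Omega> \<inter> frontier (E (Suc k))) (\<Omega> \<inter> frontier (E k)) > 0"
      using E by (auto simp: chain_def)
    then obtain \<epsilon> where \<epsilon>: "\<epsilon> > 0" "\<And>\<gamma>. continuum \<gamma> \<Longrightarrow> \<gamma> \<subseteq> \<Omega> \<Longrightarrow>
        \<gamma> \<inter> (\<Omega> \<inter> frontier (E (Suc k))) \<noteq> {} \<Longrightarrow> \<gamma> \<inter> (\<Omega> \<inter> frontier (E k)) \<noteq> {} \<Longrightarrow> \<epsilon> \<le> diameter \<gamma>"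
      unfolding dist_M_pos_iff by blast
    obtain \<delta> where \<delta>: "\<delta> > 0"
      "\<And>\<gamma>. continuum \<gamma> \<Longrightarrow> \<gamma> \<subseteq> \<Omega>' \<Longrightarrow> diameter \<gamma> < \<delta> \<Longrightarrow> diameter (g ` \<gamma>) < \<epsilon>"
      using small \<epsilon>(1) unfolding preserves_small_continua_def by blast
    have "\<delta> \<le> diameter \<gamma>" if \<gamma>: "continuum \<gamma>" "\<gamma> \<subseteq> \<Omega>'"
      "\<gamma> \<inter> f ` (\<Omega> \<inter> frontier (E (Suc k))) \<noteq> {}" "\<gamma> \<inter> f ` (\<Omega> \<inter> frontier (E k)) \<noteq> {}" for \<gamma>
    proof -
      have meets: "g ` \<gamma> \<inter> (\<Omega> \<inter> B) \<noteq> {}" if "\<gamma> \<inter> f ` (\<Omega> \<inter> B) \<noteq> {}" for B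
      proof -
        obtain x where x: "x \<in> \<Omega> \<inter> B" "f x \<in> \<gamma>" using \<open>\<gamma> \<inter> f ` (\<Omega> \<inter> B) \<noteq> {}\<close> by blast
        then have "x \<in> g ` \<gamma>" using gf[of x] by (metis IntD1 image_eqI)
        with x show ?thesis by blast
      qed
      have "\<epsilon> \<le> diameter (g ` \<gamma>)"
        using \<gamma>(1,2) im(2) meets[OF \<gamma>(3)] meets[OF \<gamma>(4)]
        by (intro \<epsilon>(2) continuum_image[OF im(4)]) auto
      then show ?thesis using \<delta>(2)[OF \<gamma>(1,2)] by linarith
    qed
    then show ?thesis
      unfolding dist_M_pos_iff homeomorphism_image_Int_frontier[OF hom op sub, symmetric]
      using \<delta>(1) by blast
  qed
  show "(\<Inter>k. closure (f ` E k)) \<subseteq> frontier \<Omega>'"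
  proof
    fix y assume y: "y \<in> (\<Inter>k. closure (f ` E k))"
    have "y \<in> closure \<Omega>'" using y sub im(1) closure_mono[of "f ` E 0" \<Omega>'] by blast
    \<comment> \<open>A point of the intersection lying in \<open>\<Omega>'\<close> would pull back
      to a point of \<open>\<Omega>\<close> in the closure of every \<open>E k\<close>, against
      condition (c).\<close>
    moreover have "y \<notin> \<Omega>'"
    proof
      assume "y \<in> \<Omega>'"
      then have "y \<in> f ` (\<Omega> \<inter> closure (E k))" for k
        using y homeomorphism_image_Int_closure[OF hom sub] by blast
      then have "g y \<in> \<Omega> \<inter> closure (E k)" for k using gf by force
      moreover have "(\<Inter>k. closure (E k)) \<subseteq> frontier \<Omega>" using E by (auto simp: chain_def)
      ultimately have "g y \<in> frontier \<Omega>" "g y \<in> \<Omega>" by blast+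
      then show False using op(1) by (auto simp: frontier_def interior_open)
    qed
    ultimately show "y \<in> frontier \<Omega>'" using op(2) by (auto simp: frontier_def interior_open)
  qed
qed


section \<open>The induced map of prime end closures\<close>

lemma chain_divides_image:
  "chain_divides E F \<Longrightarrow> chain_divides (\<lambda>k. f ` E k) (\<lambda>k. f ` F k)"
  unfolding chain_divides_def using image_mono[of "E _" "F _" f] by metis

text \<open>Maps every representative of the class, so that no choice is made;
  \<open>end_image_end_of\<close> shows that the result is again a full class.\<close>

definition end_image :: "('a \<Rightarrow> 'b) \<Rightarrow> (nat \<Rightarrow> 'a set) set \<Rightarrow> (nat \<Rightarrow> 'b set) set" where
  "end_image f \<E> = (\<lambda>E k. f ` E k) ` \<E>"

lemma end_divides_image: "end_divides \<E> \<F> \<Longrightarrow> end_divides (end_image f \<E>) (end_image f \<F>)"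
  unfolding end_divides_def end_image_def by (auto intro!: bexI chain_divides_image)

lemma ends_tendsto_end_image:
  assumes "ends_tendsto_end \<P> \<E>"
  shows "ends_tendsto_end (\<lambda>j. end_image f (\<P> j)) (end_image f \<E>)"
  unfolding ends_tendsto_end_def
proof (intro ballI allI)
  fix E' k assume "E' \<in> end_image f \<E>"
  then obtain E where E: "E \<in> \<E>" "E' = (\<lambda>k. f ` E k)" by (auto simp: end_image_def)
  then obtain N where N: "\<forall>j\<ge>N. \<forall>P\<in>\<P> j. \<exists>m. P m \<subseteq> E k"
    using assms unfolding ends_tendsto_end_def by blast
  have "\<exists>m. P' m \<subseteq> E' k" if j: "N \<le> j" and P': "P' \<in> end_image f (\<P> j)" for j P'
  proof -
    obtain P where P: "P \<in> \<P> j" "P' = (\<lambda>k. f ` P k)" using P' by (auto simp: end_image_def)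
    obtain m where "P m \<subseteq> E k" using N[rule_format, OF j P(1)] ..
    then have "P' m \<subseteq> E' k" unfolding P(2) E(2) by (rule image_mono)
    then show ?thesis ..
  qed
  then show "\<exists>N. \<forall>j\<ge>N. \<forall>P\<in>end_image f (\<P> j). \<exists>m. P m \<subseteq> E' k"
    by (intro exI[of _ N]) simp
qed

lemma points_tendsto_end_image:
  assumes "points_tendsto_end x \<E>"
  shows "points_tendsto_end (\<lambda>j. f (x j)) (end_image f \<E>)"
  unfolding points_tendsto_end_def
proof (intro ballI allI)
  fix E' k assume "E' \<in> end_image f \<E>"
  then obtain E where E: "E \<in> \<E>" "E' = (\<lambda>k. f ` E k)" by (auto simp: end_image_def)
  then obtain N where "\<forall>j\<ge>N. x j \<in> E k"
    using assms unfolding points_tendsto_end_def by blast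
  then show "\<exists>N. \<forall>j\<ge>N. f (x j) \<in> E' k" unfolding E(2) by blast
qed

section \<open>From chains to ends and prime ends\<close>

lemma ends_cases:
  assumes "\<E> \<in> ends \<Omega>"
  obtains E where "chain \<Omega> E" "\<E> = end_of \<Omega> E"
  using assms by (auto simp: ends_def end_of_def quotient_def)

lemma end_of_in_ends: "chain \<Omega> E \<Longrightarrow> end_of \<Omega> E \<in> ends \<Omega>"
  by (auto simp: ends_def end_of_def intro: quotientI)

text \<open>Retains from the BQS property only that chains correspond under \<open>f\<close> and
  \<open>g\<close>. The conditions are symmetric, so each result for \<open>f\<close> also holds for
  \<open>g\<close>.\<close>

locale chain_homeomorphism =
  fixes \<Omega> :: "'a::metric_space set" and \<Omega>' :: "'b::metric_space set"
    and f :: "'a \<Rightarrow> 'b" and g :: "'b \<Rightarrow> 'a"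
  assumes hom: "homeomorphism \<Omega> \<Omega>' f g"
    and chain_im: "chain \<Omega> E \<Longrightarrow> chain \<Omega>' (\<lambda>k. f ` E k)"
    and chain_inv_im: "chain \<Omega>' E' \<Longrightarrow> chain \<Omega> (\<lambda>k. g ` E' k)"
begin

lemma inverse: "chain_homeomorphism \<Omega>' \<Omega> g f"
  using homeomorphism_symD[OF hom] chain_im chain_inv_im by unfold_locales

lemma chain_inverse_image:
  assumes "chain \<Omega> E"
  shows "(\<lambda>k. g ` f ` E k) = E"
proof
  fix k
  have "E k \<subseteq> \<Omega>" using assms by (auto simp: chain_def acceptable_def)
  then have "g ` f ` E k = (\<lambda>x. x) ` E k"
    unfolding image_image using hom by (intro image_cong) (auto simp: homeomorphism_def)
  then show "g ` f ` E k = E k" by simp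
qed

lemma chain_equiv_image:
  "(E, F) \<in> chain_equiv \<Omega> \<Longrightarrow> ((\<lambda>k. f ` E k), (\<lambda>k. f ` F k)) \<in> chain_equiv \<Omega>'"
  using chain_im chain_divides_image by (auto simp: chain_equiv_def)

end

text \<open>The context is reopened whenever \<open>inv\<close> has to cover facts proved since the last interpretation.\<close>

context chain_homeomorphism
begin

interpretation inv: chain_homeomorphism \<Omega>' \<Omega> g f by (rule inverse)

text \<open>Well-definedness on ends. For the reverse inclusion, a chain equivalent to the image of
  \<open>E\<close> is pulled back by \<open>g\<close> to a chain equivalent to \<open>E\<close>, of
  which it is the image.\<close>

lemma end_image_end_of:
  assumes E: "chain \<Omega> E"
  shows "end_image f (end_of \<Omega> E) = end_of \<Omega>' (\<lambda>k. f ` E k)"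
proof
  show "end_image f (end_of \<Omega> E) \<subseteq> end_of \<Omega>' (\<lambda>k. f ` E k)"
    using chain_equiv_image by (auto simp: end_image_def end_of_def)
next
  show "end_of \<Omega>' (\<lambda>k. f ` E k) \<subseteq> end_image f (end_of \<Omega> E)"
  proof
    fix F' assume "F' \<in> end_of \<Omega>' (\<lambda>k. f ` E k)"
    then have F': "((\<lambda>k. f ` E k), F') \<in> chain_equiv \<Omega>'" by (simp add: end_of_def)
    then have "(E, (\<lambda>k. g ` F' k)) \<in> chain_equiv \<Omega>"
      using inv.chain_equiv_image chain_inverse_image[OF E] by fastforce
    moreover have "F' = (\<lambda>k. f ` g ` F' k)"
      using F' inv.chain_inverse_image by (simp add: chain_equiv_def)
    ultimately show "F' \<in> end_image f (end_of \<Omega> E)"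
      unfolding end_image_def end_of_def by (intro image_eqI[of _ _ "\<lambda>k. g ` F' k"]) auto
  qed
qed

end

context chain_homeomorphism
begin

interpretation inv: chain_homeomorphism \<Omega>' \<Omega> g f by (rule inverse)

lemma end_image_in_ends: "\<E> \<in> ends \<Omega> \<Longrightarrow> end_image f \<E> \<in> ends \<Omega>'"
  using end_image_end_of end_of_in_ends chain_im by (metis ends_cases)

lemma end_image_inverse: "\<E> \<in> ends \<Omega> \<Longrightarrow> end_image g (end_image f \<E>) = \<E>"
  using end_image_end_of inv.end_image_end_of chain_im chain_inverse_image
  by (elim ends_cases) simp

end

context chain_homeomorphism
begin

interpretation inv: chain_homeomorphism \<Omega>' \<Omega> g f by (rule inverse)

text \<open>Minimality transfers by pulling back: an end dividing the image of \<open>\<E>\<close>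
  goes under \<open>g\<close> to an end dividing \<open>\<E>\<close>, hence to \<open>\<E>\<close>
  itself.\<close>

lemma end_image_in_prime_ends:
  assumes "\<E> \<in> prime_ends \<Omega>"
  shows "end_image f \<E> \<in> prime_ends \<Omega>'"
  unfolding prime_ends_def
proof (intro CollectI conjI ballI impI)
  have \<E>: "\<E> \<in> ends \<Omega>" "\<And>\<F>. \<F> \<in> ends \<Omega> \<Longrightarrow> end_divides \<F> \<E> \<Longrightarrow> \<F> = \<E>"
    using assms by (auto simp: prime_ends_def)
  show "end_image f \<E> \<in> ends \<Omega>'" using \<E>(1) by (rule end_image_in_ends)
  fix \<F> assume \<F>: "\<F> \<in> ends \<Omega>'" "end_divides \<F> (end_image f \<E>)"
  have "end_divides (end_image g \<F>) \<E>"
    using end_divides_image[OF \<F>(2), of g] end_image_inverse[OF \<E>(1)] by simp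
  then have "end_image g \<F> = \<E>" using \<E>(2) inv.end_image_in_ends[OF \<F>(1)] by blast
  then show "\<F> = end_image f \<E>" using inv.end_image_inverse[OF \<F>(1)] by simp
qed

section \<open>Homeomorphism of the prime end closures\<close>

abbreviation pe_map :: "'a pe_point \<Rightarrow> 'b pe_point" where
  "pe_map \<equiv> map_sum f (end_image f)"

lemma pe_map_in: "p \<in> prime_end_closure \<Omega> \<Longrightarrow> pe_map p \<in> prime_end_closure \<Omega>'"
  using end_image_in_prime_ends hom by (auto simp: prime_end_closure_def homeomorphism_def)

lemma pe_tendsto_map:
  assumes "pe_tendsto \<Omega> s l"
  shows "pe_tendsto \<Omega>' (\<lambda>j. pe_map (s j)) (pe_map l)"
proof -
  have f: "f ` \<Omega> = \<Omega>'" "continuous_on \<Omega> f" using hom by (auto simp: homeomorphism_def)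
  show ?thesis
  proof (cases l)
    case (Inl x)
    then obtain y N where x: "x \<in> \<Omega>" and y: "\<forall>j\<ge>N. y j \<in> \<Omega> \<and> s j = Inl (y j)" "y \<longlonglongrightarrow> x"
      using assms by auto
    \<comment> \<open>Only a tail of \<open>y\<close> is known to lie in \<open>\<Omega>\<close>,
      which is enough for continuity on \<open>\<Omega>\<close>.\<close>
    have "eventually (\<lambda>j. y j \<in> \<Omega>) sequentially"
      using y(1) by (auto simp: eventually_sequentially)
    then have "(\<lambda>j. f (y j)) \<longlonglongrightarrow> f x"
      by (rule continuous_on_tendsto_compose[OF f(2) y(2) x])
    moreover have "\<forall>j\<ge>N. f (y j) \<in> \<Omega>' \<and> pe_map (s j) = Inl (f (y j))"
      using y(1) f(1) by auto
    ultimately show ?thesis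
      using x f(1) unfolding Inl map_sum.simps pe_tendsto.simps
      by (intro conjI exI[of _ "\<lambda>j. f (y j)"] exI[of _ N]) auto
  next
    case (Inr \<E>)
    then have \<E>: "end_image f \<E> \<in> prime_ends \<Omega>'"
      using assms end_image_in_prime_ends by simp
    from assms Inr consider
      x where "\<forall>j. x j \<in> \<Omega> \<and> s j = Inl (x j)" "points_tendsto_end x \<E>" |
      \<P> where "\<forall>j. \<P> j \<in> prime_ends \<Omega> \<and> s j = Inr (\<P> j)" "ends_tendsto_end \<P> \<E>"
      by auto
    then show ?thesis
    proof cases
      case 1
      then have "\<forall>j. f (x j) \<in> \<Omega>' \<and> pe_map (s j) = Inl (f (x j))" using f(1) by auto
      with points_tendsto_end_image[OF 1(2), of f] \<E> show ?thesis
        unfolding Inr map_sum.simps pe_tendsto.simps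
        by (intro conjI disjI1 exI[of _ "\<lambda>j. f (x j)"]) auto
    next
      case 2
      then have "\<forall>j. end_image f (\<P> j) \<in> prime_ends \<Omega>' \<and> pe_map (s j) = Inr (end_image f (\<P> j))"
        using end_image_in_prime_ends by auto
      with ends_tendsto_end_image[OF 2(2), of f] \<E> show ?thesis
        unfolding Inr map_sum.simps pe_tendsto.simps
        by (intro conjI disjI2 exI[of _ "\<lambda>j. end_image f (\<P> j)"]) auto
    qed
  qed
qed

text \<open>Closed sets are defined by sequential limits, so preservation of these limits already
  makes preimages of closed sets closed.\<close>

lemma continuous_map_pe_map: "continuous_map (pe_topology \<Omega>) (pe_topology \<Omega>') pe_map"
  unfolding continuous_map_closedin topspace_pe_topology closedin_pe_topology
proof (intro conjI allI impI)
  show "pe_map \<in> prime_end_closure \<Omega> \<rightarrow> prime_end_closure \<Omega>'" using pe_map_in by blast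
  fix C assume C: "pe_closed \<Omega>' C"
  show "pe_closed \<Omega> {p \<in> prime_end_closure \<Omega>. pe_map p \<in> C}"
    unfolding pe_closed_def
  proof (intro conjI allI impI)
    fix s l assume s: "(\<forall>j. s j \<in> {p \<in> prime_end_closure \<Omega>. pe_map p \<in> C}) \<and> pe_tendsto \<Omega> s l"
    then have "pe_map l \<in> C"
      using C[unfolded pe_closed_def, THEN conjunct2, rule_format, of "\<lambda>j. pe_map (s j)"]
        pe_tendsto_map[of s l] by blast
    then show "l \<in> {p \<in> prime_end_closure \<Omega>. pe_map p \<in> C}" using s pe_tendsto_in by blast
  qed blast
qed

lemma pe_map_inverse:
  "p \<in> prime_end_closure \<Omega> \<Longrightarrow> map_sum g (end_image g) (pe_map p) = p"
  using hom end_image_inverse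
  by (auto simp: prime_end_closure_def prime_ends_def homeomorphism_def)

end

context chain_homeomorphism
begin

interpretation inv: chain_homeomorphism \<Omega>' \<Omega> g f by (rule inverse)

lemma homeomorphic_map_pe_map: "homeomorphic_map (pe_topology \<Omega>) (pe_topology \<Omega>') pe_map"
proof -
  have "homeomorphic_maps (pe_topology \<Omega>) (pe_topology \<Omega>') pe_map inv.pe_map"
    unfolding homeomorphic_maps_def topspace_pe_topology
    using continuous_map_pe_map inv.continuous_map_pe_map pe_map_inverse inv.pe_map_inverse
    by blast
  then show ?thesis by (simp add: homeomorphic_maps_map)
qed

end

theorem theorem4p4:
  fixes \<Omega> :: "'a::metric_space set" and \<Omega>' :: "'b::metric_space set" and f :: "'a \<Rightarrow> 'b"
  assumes "complete (UNIV :: 'a set)" and "complete (UNIV :: 'b set)"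
    and "doubling (UNIV :: 'a set)" and "doubling (UNIV :: 'b set)"
    and "locally path_connected (UNIV :: 'a set)" and "locally path_connected (UNIV :: 'b set)"
    and "domain \<Omega>" and "bounded \<Omega>"
    and "domain \<Omega>'" and "bounded \<Omega>'"
    and "BQS_homeomorphism \<Omega> \<Omega>' f"
  shows "\<exists>f\<^sub>P :: 'a pe_point \<Rightarrow> 'b pe_point.
           homeomorphic_map (pe_topology \<Omega>) (pe_topology \<Omega>') f\<^sub>P \<and>
           (\<forall>x\<in>\<Omega>. f\<^sub>P (Inl x) = Inl (f x)) \<and>
           (\<forall>E. chain \<Omega> E \<and> end_of \<Omega> E \<in> prime_ends \<Omega> \<longrightarrow>
                chain \<Omega>' (\<lambda>k. f ` E k) \<and>
                end_of \<Omega>' (\<lambda>k. f ` E k) \<in> prime_ends \<Omega>' \<and>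
                f\<^sub>P (Inr (end_of \<Omega> E)) = Inr (end_of \<Omega>' (\<lambda>k. f ` E k)))"
proof -
  obtain g \<eta> where hom: "homeomorphism \<Omega> \<Omega>' f g"
    and \<eta>: "mono_on {0<..} \<eta>" "(\<eta> \<longlongrightarrow> 0) (at_right (0::real))"
    and bqs: "\<And>E F. nondegenerate_continuum E \<Longrightarrow> nondegenerate_continuum F \<Longrightarrow> E \<subseteq> \<Omega> \<Longrightarrow> F \<subseteq> \<Omega> \<Longrightarrow>
           E \<inter> F \<noteq> {} \<Longrightarrow> diameter (f ` E) / diameter (f ` F) \<le> \<eta> (diameter E / diameter F)"
    using assms(11) unfolding BQS_homeomorphism_def by auto
  have op: "open \<Omega>" "open \<Omega>'" using assms(7,9) by (auto simp: domain_def)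
  note pc = path_connected_domain[OF assms(5,7)]
  note small = BQS_preserves_small_continua[OF hom pc assms(8,10) \<eta> bqs]
  interpret chain_homeomorphism \<Omega> \<Omega>' f g
  proof
    \<comment> \<open>The roles cross: images under \<open>f\<close> are chains because
      \<open>g\<close> preserves small continua, and conversely.\<close>
    show "chain \<Omega>' (\<lambda>k. f ` E k)" if "chain \<Omega> E" for E
      using compact_closure_if_doubling[OF assms(2,4)] small(2) that
      by (intro chain_image[OF hom op assms(10)]) auto
    show "chain \<Omega> (\<lambda>k. g ` E k)" if "chain \<Omega>' E" for E
      using compact_closure_if_doubling[OF assms(1,3)] small(1) that
      by (intro chain_image[OF homeomorphism_symD[OF hom] op(2,1) assms(8)]) auto
  qed (rule hom)
  show ?thesis
    using homeomorphic_map_pe_map chain_im end_image_end_of end_image_in_prime_ends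
    by (intro exI[of _ pe_map]) (metis map_sum.simps)
qed

end
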